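(* Let $X$ be a path connected, locally path connected space, $x\in X$, and let $H\subsetneqq\pi_1(X,x)$. (1) If $H$ is closed in $\pi_1^{qtop}(X,x)$, then $\pi_H^{qs}(X,x)=H$. (2) $\pi_1^{qtop}(X,x)$ is $T_1$ if and only if $\pi_1^{qs}(X,x)=1$.
   Context: All spaces are assumed path connected. $I=[0,1]$, $\dot I=\{0,1\}$; $\simeq$ rel $\dot I$ denotes homotopy of paths relative to endpoints, and $[f]$ is the homotopy class of a path $f$ rel $\dot I$. $c_x$ is the constant path at $x$. Closeness: let $f,g:I\to X$ be paths with $f(0)=g(0)$ and $f(1)=g(1)$. We say $f$ is homotopically close to $g$ rel $\dot I$ (written $f\xrightarrow{close} g$ rel $\dot I$) if for every partition $0=t_0<t_1<\cdots<t_n=1$ and every sequence of open sets $U_1,\ldots,U_n$ of $X$ with $g([t_{i-1},t_i])\subset U_i$ for all $i$, there is a path $\gamma$ with $\gamma([t_{i-1},t_i])\subset U_i$ for $1\le i\le n$, $\gamma(t_i)=g(t_i)$ for $0\le i\le n$, and $\gamma\simeq f$ rel $\dot I$. For a subset $H\subseteq\pi_1(X,x)$, $\pi_H^{qs}(X,x)=\{[f]\in\pi_1(X,x) : f\xrightarrow{close} h \text{ rel } \dot I \text{ for some loop } h \text{ at } x \text{ with } [h]\in H\}$. For $H=\{[c_x]\}$ the trivial subgroup, write $\pi_1^{qs}(X,x)$. Quasi-topological fundamental group: $\pi_1^{qtop}(X,x)$ is the group $\pi_1(X,x)$ with the quotient topology induced by the map $f\mapsto[f]$ from the set of loops in $X$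 based at $x$, equipped with the compact-open topology. (It is a quasi-topological group: inversion and all left and right translations are continuous.) *)

theory Defs
  imports "HOL-Analysis.Analysis" "HOL-Algebra.Group"
begin

text \<open>
  The space is a set \<open>S\<close> in a type of class \<open>topological_space\<close>, with the subspace topology.
  Paths are functions on the reals, of which only the restriction to the unit interval matters.
\<close>

definition loops_at :: "'a::topological_space set \<Rightarrow> 'a \<Rightarrow> (real \<Rightarrow> 'a) set" where
  "loops_at S x = {f. path f \<and> path_image f \<subseteq> S \<and> pathstart f = x \<and> pathfinish f = x}"

definition path_class :: "'a::topological_space set \<Rightarrow> (real \<Rightarrow> 'a) \<Rightarrow> (real \<Rightarrow> 'a) set" where
  "path_class S f = {g. homotopic_paths S f g}"

definition fundamental_group :: "'a::topological_space set \<Rightarrow> 'a \<Rightarrow> (real \<Rightarrow> 'a) set monoid" where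
  "fundamental_group S x =
     \<lparr>carrier = path_class S ` loops_at S x,
      mult = (\<lambda>A B. {h. \<exists>f\<in>A. \<exists>g\<in>B. homotopic_paths S (f +++ g) h}),
      one = path_class S (\<lambda>_. x)\<rparr>"

definition homotopically_close ::
    "'a::topological_space set \<Rightarrow> (real \<Rightarrow> 'a) \<Rightarrow> (real \<Rightarrow> 'a) \<Rightarrow> bool" where
  "homotopically_close S f g \<longleftrightarrow>
     path f \<and> path_image f \<subseteq> S \<and> path g \<and> path_image g \<subseteq> S \<and>
     pathstart f = pathstart g \<and> pathfinish f = pathfinish g \<and>
     (\<forall>(n::nat) (t::nat \<Rightarrow> real) (U::nat \<Rightarrow> 'a set).
        t 0 = 0 \<and> t n = 1 \<and> (\<forall>i<n. t i < t (Suc i)) \<and>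
        (\<forall>i\<in>{1..n}. openin (top_of_set S) (U i) \<and> g ` {t (i - 1)..t i} \<subseteq> U i) \<longrightarrow>
        (\<exists>\<gamma>. path \<gamma> \<and> path_image \<gamma> \<subseteq> S \<and>
           (\<forall>i\<in>{1..n}. \<gamma> ` {t (i - 1)..t i} \<subseteq> U i) \<and>
           (\<forall>i\<in>{0..n}. \<gamma> (t i) = g (t i)) \<and>
           homotopic_paths S \<gamma> f))"

definition pi_qs ::
    "'a::topological_space set \<Rightarrow> 'a \<Rightarrow> (real \<Rightarrow> 'a) set set \<Rightarrow> (real \<Rightarrow> 'a) set set" where
  "pi_qs S x H =
     {path_class S f |f. f \<in> loops_at S x \<and>
        (\<exists>h\<in>loops_at S x. path_class S h \<in> H \<and> homotopically_close S f h)}"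

text \<open>
  Continuous maps are taken to be extensional on the domain, so that points of the
  function space correspond exactly to maps from \<open>X\<close> to \<open>Y\<close>.
\<close>

definition compact_open_topology :: "'a topology \<Rightarrow> 'b topology \<Rightarrow> ('a \<Rightarrow> 'b) topology" where
  "compact_open_topology X Y =
     topology_generated_by
       {{f \<in> extensional (topspace X). continuous_map X Y f \<and> f ` K \<subseteq> U} |K U.
          compactin X K \<and> openin Y U}"

lemma topspace_compact_open_topology:
  "topspace (compact_open_topology X Y) = {f \<in> extensional (topspace X). continuous_map X Y f}"
proof -
  have "\<exists>K U. {f \<in> extensional (topspace X). continuous_map X Y f} =
          {f \<in> extensional (topspace X). continuous_map X Y f \<and> f ` K \<subseteq> U} \<and>
          compactin X K \<and> openin Y U"
    by (rule exI[of _ "{}"], rule exI[of _ "{}"]) auto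
  then show ?thesis
    unfolding compact_open_topology_def topology_generated_by_topspace by blast
qed

definition loop_space :: "'a::topological_space set \<Rightarrow> 'a \<Rightarrow> (real \<Rightarrow> 'a) topology" where
  "loop_space S x =
     subtopology (compact_open_topology (top_of_set {0..1}) (top_of_set S)) (loops_at S x)"

lemma topspace_loop_space:
  "topspace (loop_space S x) = loops_at S x \<inter> extensional {0..1}"
  by (auto simp: loop_space_def topspace_compact_open_topology loops_at_def path_def path_image_def)

definition quotient_topology :: "'a topology \<Rightarrow> ('a \<Rightarrow> 'b) \<Rightarrow> 'b topology" where
  "quotient_topology X q =
     topology (\<lambda>U. U \<subseteq> q ` topspace X \<and> openin X {x \<in> topspace X. q x \<in> U})"

lemma openin_quotient_topology:
  "openin (quotient_topology X q) U \<longleftrightarrow>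
     U \<subseteq> q ` topspace X \<and> openin X {x \<in> topspace X. q x \<in> U}"
proof -
  have "istopology (\<lambda>U. U \<subseteq> q ` topspace X \<and> openin X {x \<in> topspace X. q x \<in> U})"
    unfolding istopology_def
  proof (rule conjI; clarify)
    fix A B
    assume "openin X {x \<in> topspace X. q x \<in> A}" "openin X {x \<in> topspace X. q x \<in> B}"
      and A: "A \<subseteq> q ` topspace X"
    then have "openin X ({x \<in> topspace X. q x \<in> A} \<inter> {x \<in> topspace X. q x \<in> B})"
      by (intro openin_Int)
    moreover have "{x \<in> topspace X. q x \<in> A \<inter> B} =
        {x \<in> topspace X. q x \<in> A} \<inter> {x \<in> topspace X. q x \<in> B}"
      by auto
    ultimately show "A \<inter> B \<subseteq> q ` topspace X \<and> openin X {x \<in> topspace X. q x \<in> A \<inter> B}"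
      using A by (simp only:) blast
  next
    fix \<K> assume *: "\<forall>K\<in>\<K>. K \<subseteq> q ` topspace X \<and> openin X {x \<in> topspace X. q x \<in> K}"
    have "{x \<in> topspace X. q x \<in> \<Union>\<K>} = (\<Union>K\<in>\<K>. {x \<in> topspace X. q x \<in> K})"
      by auto
    moreover have "openin X (\<Union>K\<in>\<K>. {x \<in> topspace X. q x \<in> K})"
      using * by (intro openin_clauses(3)) blast
    ultimately show "\<Union>\<K> \<subseteq> q ` topspace X \<and> openin X {x \<in> topspace X. q x \<in> \<Union>\<K>}"
      using * by (simp add: Sup_le_iff)
  qed
  then show ?thesis
    unfolding quotient_topology_def by (simp only: topology_inverse')
qed

lemma topspace_quotient_topology: "topspace (quotient_topology X q) = q ` topspace X"
proof
  show "topspace (quotient_topology X q) \<subseteq> q ` topspace X"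
    using openin_topspace[of "quotient_topology X q"] unfolding openin_quotient_topology
    by (rule conjunct1)
  have "{x \<in> topspace X. q x \<in> q ` topspace X} = topspace X"
    by auto
  then have "openin (quotient_topology X q) (q ` topspace X)"
    by (simp add: openin_quotient_topology)
  then show "q ` topspace X \<subseteq> topspace (quotient_topology X q)"
    by (rule openin_subset)
qed

lemma quotient_map_quotient_topology: "quotient_map X (quotient_topology X q) q"
  by (simp add: quotient_map_def topspace_quotient_topology openin_quotient_topology)

definition pi1_qtop :: "'a::topological_space set \<Rightarrow> 'a \<Rightarrow> (real \<Rightarrow> 'a) set topology" where
  "pi1_qtop S x = quotient_topology (loop_space S x) (path_class S)"

lemma path_class_eq_iff:
  assumes "path f" "path_image f \<subseteq> S"
  shows "path_class S f = path_class S g \<longleftrightarrow> homotopic_paths S f g"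
proof
  assume "path_class S f = path_class S g"
  moreover have "f \<in> path_class S f"
    using assms by (simp add: path_class_def)
  ultimately show "homotopic_paths S f g"
    by (simp add: path_class_def homotopic_paths_sym)
next
  assume "homotopic_paths S f g"
  then show "path_class S f = path_class S g"
    unfolding path_class_def
    using homotopic_paths_trans[of S f g] homotopic_paths_trans[of S g f] homotopic_paths_sym[of S f g]
    by auto
qed

lemma topspace_pi1_qtop: "topspace (pi1_qtop S x) = carrier (fundamental_group S x)"
proof -
  have "path_class S f \<in> path_class S ` (loops_at S x \<inter> extensional {0..1})"
    if f: "f \<in> loops_at S x" for f
  proof -
    let ?g = "restrict f {0..1}"
    have h: "homotopic_paths S f ?g"
      using f by (intro homotopic_paths_eq) (auto simp: loops_at_def)
    then have "?g \<in> loops_at S x"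
      using f homotopic_paths_imp_path[OF h] homotopic_paths_imp_subset[OF h]
      by (auto simp: loops_at_def pathstart_def pathfinish_def)
    moreover have "path_class S f = path_class S ?g"
      using f h by (subst path_class_eq_iff) (auto simp: loops_at_def)
    ultimately show ?thesis
      by auto
  qed
  then show ?thesis
    by (auto simp: pi1_qtop_def topspace_quotient_topology topspace_loop_space fundamental_group_def)
qed

lemma const_in_loops_at: "x \<in> S \<Longrightarrow> (\<lambda>_. x) \<in> loops_at S x"
  by (auto simp: loops_at_def path_def path_image_def pathstart_def pathfinish_def)

lemma join_in_loops_at: "f \<in> loops_at S x \<Longrightarrow> g \<in> loops_at S x \<Longrightarrow> f +++ g \<in> loops_at S x"
  by (auto simp: loops_at_def subset_path_image_join)

lemma reversepath_in_loops_at: "f \<in> loops_at S x \<Longrightarrow> reversepath f \<in> loops_at S x"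
  by (auto simp: loops_at_def)

lemma path_class_eqI: "homotopic_paths S f g \<Longrightarrow> path_class S f = path_class S g"
  by (meson homotopic_paths_imp_path homotopic_paths_imp_subset path_class_eq_iff)

lemma homotopic_const_join:
  assumes f: "f \<in> loops_at S x"
  shows "homotopic_paths S ((\<lambda>_. x) +++ f) f"
proof -
  have "homotopic_paths S f ((\<lambda>_. x) +++ f)"
  proof (rule homotopic_paths_reparametrize[where f = "\<lambda>t. max 0 (2 * t - 1)"])
    show "continuous_on {0..1} (\<lambda>t::real. max 0 (2 * t - 1))"
      by (intro continuous_intros)
    show "((\<lambda>_. x) +++ f) t = f (max 0 (2 * t - 1))" if "t \<in> {0..1}" for t
    proof (cases "t \<le> 1/2")
      case True
      then have "max 0 (2 * t - 1) = 0" by simp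
      with True f show ?thesis by (simp add: joinpaths_def loops_at_def pathstart_def)
    next
      case False
      then have "max 0 (2 * t - 1) = 2 * t - 1" by simp
      with False show ?thesis by (simp add: joinpaths_def)
    qed
  qed (use f in \<open>auto simp: loops_at_def\<close>)
  then show ?thesis
    by (rule homotopic_paths_sym)
qed

lemma homotopic_reversepath_join:
  assumes f: "f \<in> loops_at S x"
  shows "homotopic_paths S (reversepath f +++ f) (\<lambda>_. x)"
proof -
  define k where "k t = max (1 - 2 * t) (2 * t - 1)" for t :: real
  have cf: "continuous_on {0..1} f" and fS: "f ` {0..1} \<subseteq> S" and f1: "f 1 = x"
    using f by (auto simp: loops_at_def path_def path_image_def pathfinish_def)
  have k01: "0 \<le> k t" "k t \<le> 1" if "0 \<le> t" "t \<le> 1" for t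
    using that by (auto simp: k_def max_def)
  define a where "a y = fst y + (1 - fst y) * k (snd y)" for y :: "real \<times> real"
  have a01: "a y \<in> {0..1}" if "y \<in> {0..1} \<times> {0..1}" for y
  proof -
    have y: "0 \<le> fst y" "fst y \<le> 1" "0 \<le> k (snd y)" "k (snd y) \<le> 1"
      using that k01 by (auto simp: mem_Times_iff)
    then have "0 \<le> (1 - fst y) * k (snd y)" "(1 - fst y) * k (snd y) \<le> (1 - fst y) * 1"
      by (simp, intro mult_left_mono) auto
    with y show ?thesis
      by (auto simp: a_def)
  qed
  have ca: "continuous_on ({0..1} \<times> {0..1}) a"
    unfolding a_def k_def by (intro continuous_intros)
  have "continuous_on ({0..1} \<times> {0..1}) (f \<circ> a)"
    using a01 by (intro continuous_on_compose ca continuous_on_subset[OF cf]) auto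
  moreover have "f \<circ> a \<in> {0..1} \<times> {0..1} \<rightarrow> S"
    using a01 fS by fastforce
  moreover have "(f \<circ> a) (0, t) = (reversepath f +++ f) t" if "t \<in> {0..1}" for t
  proof (cases "t \<le> 1/2")
    case True
    then have "k t = 1 - 2 * t" by (simp add: k_def)
    with True show ?thesis by (simp add: a_def joinpaths_def reversepath_def)
  next
    case False
    then have "k t = 2 * t - 1" by (simp add: k_def)
    with False show ?thesis by (simp add: a_def joinpaths_def)
  qed
  moreover have "(f \<circ> a) (1, t) = x" for t
    using f1 by (simp add: a_def)
  moreover have "pathstart ((f \<circ> a) \<circ> Pair t) = pathstart (reversepath f +++ f)"
    and "pathfinish ((f \<circ> a) \<circ> Pair t) = pathfinish (reversepath f +++ f)" for t
  proof -
    have "a (t, 0) = 1" "a (t, 1) = 1"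
      by (simp_all add: a_def k_def)
    then show "pathstart ((f \<circ> a) \<circ> Pair t) = pathstart (reversepath f +++ f)"
      and "pathfinish ((f \<circ> a) \<circ> Pair t) = pathfinish (reversepath f +++ f)"
      by (simp_all add: pathstart_def[of "_ \<circ> _"] pathfinish_def[of "_ \<circ> _"])
        (simp_all add: pathfinish_def)
  qed
  ultimately show ?thesis
    unfolding homotopic_paths by (intro exI[of _ "f \<circ> a"] conjI ballI)
qed

lemma fundamental_group_mult:
  assumes "f \<in> loops_at S x" "g \<in> loops_at S x"
  shows "path_class S f \<otimes>\<^bsub>fundamental_group S x\<^esub> path_class S g = path_class S (f +++ g)"
proof -
  have fg: "homotopic_paths S f f" "homotopic_paths S g g" "pathfinish f = pathstart g"
    using assms by (auto simp: loops_at_def)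
  have "homotopic_paths S (f +++ g) h"
    if "homotopic_paths S f f'" "homotopic_paths S g g'" "homotopic_paths S (f' +++ g') h" for f' g' h
    using homotopic_paths_join[OF that(1,2) fg(3)] that(3) by (rule homotopic_paths_trans)
  then have "(\<exists>f'\<in>path_class S f. \<exists>g'\<in>path_class S g. homotopic_paths S (f' +++ g') h) \<longleftrightarrow>
      homotopic_paths S (f +++ g) h" for h
    using fg(1,2) unfolding path_class_def by blast
  then show ?thesis
    by (simp add: fundamental_group_def path_class_def)
qed

lemma group_fundamental_group:
  assumes "x \<in> S"
  shows "group (fundamental_group S x)" (is "group ?G")
proof (rule groupI)
  have car: "carrier ?G = path_class S ` loops_at S x"
    and one: "\<one>\<^bsub>?G\<^esub> = path_class S (\<lambda>_. x)"
    by (simp_all add: fundamental_group_def)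
  note mult = fundamental_group_mult
  show "\<one>\<^bsub>?G\<^esub> \<in> carrier ?G"
    using const_in_loops_at[OF assms] by (auto simp: car one)
  fix A assume "A \<in> carrier ?G"
  then obtain f where f: "f \<in> loops_at S x" "A = path_class S f"
    by (auto simp: car)
  show "\<one>\<^bsub>?G\<^esub> \<otimes>\<^bsub>?G\<^esub> A = A"
    using f homotopic_const_join[OF f(1)] const_in_loops_at[OF assms]
    by (simp add: one mult path_class_eqI)
  show "\<exists>B\<in>carrier ?G. B \<otimes>\<^bsub>?G\<^esub> A = \<one>\<^bsub>?G\<^esub>"
    using f homotopic_reversepath_join[OF f(1)] reversepath_in_loops_at[OF f(1)]
    by (intro bexI[of _ "path_class S (reversepath f)"])
      (simp_all add: one mult car path_class_eqI)
  fix B assume "B \<in> carrier ?G"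
  then obtain g where g: "g \<in> loops_at S x" "B = path_class S g"
    by (auto simp: car)
  show "A \<otimes>\<^bsub>?G\<^esub> B \<in> carrier ?G"
    using f g by (simp add: mult car join_in_loops_at)
  fix C assume "C \<in> carrier ?G"
  then obtain h where h: "h \<in> loops_at S x" "C = path_class S h"
    by (auto simp: car)
  have "homotopic_paths S (f +++ (g +++ h)) ((f +++ g) +++ h)"
    using f g h by (intro homotopic_paths_assoc) (auto simp: loops_at_def)
  then show "A \<otimes>\<^bsub>?G\<^esub> B \<otimes>\<^bsub>?G\<^esub> C = A \<otimes>\<^bsub>?G\<^esub> (B \<otimes>\<^bsub>?G\<^esub> C)"
    using f g h by (simp add: mult join_in_loops_at path_class_eqI)
qed

end

theory Submission
  imports Defs
begin

text \<open>
  In a locally path connected space, a loop \<open>f\<close> is homotopically close to a loop \<open>h\<close> if and only if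
  \<open>h\<close> lies in the closure, in the compact-open topology on loops, of the homotopy class of \<open>f\<close>.
  The sets of loops subordinate to a partition and open sets form a base of neighbourhoods, which
  gives one direction (\<open>homotopically_close_imp_closure\<close>) in every space. For the other
  (\<open>closure_imp_homotopically_close\<close>) a loop near \<open>h\<close> has to be deformed so that it takes
  the same values as \<open>h\<close> at the partition points; small spikes achieve this
  (\<open>homotopic_through_points\<close>).

  The relation "\<open>h\<close> lies in the closure of the class of \<open>f\<close>" has its two arguments in the
  wrong order: to conclude that \<open>[f]\<close> belongs to a closed set containing \<open>[h]\<close> one wants \<open>[f]\<close> near
  \<open>[h]\<close>. The group structure exchanges the arguments. The map \<open>g \<mapsto> f g\<inverse> h\<close> on loops is
  continuous (\<open>continuous_map_heap_op\<close>), sends the class of \<open>f\<close> to the class of \<open>h\<close> and sends \<open>h\<close> into the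
  class of \<open>f\<close>. So if \<open>f\<close> is close to \<open>h\<close> and \<open>[h]\<close> is in a closed set \<open>H\<close>, then the set of loops
  with class in \<open>H\<close> is closed and contains the image of the class of \<open>f\<close>, hence also that of \<open>h\<close>, and
  \<open>[f] \<in> H\<close>. Applied to singletons this shows that \<open>T\<^sub>1\<close> forces every loop close to a
  null-homotopic one to be null-homotopic.

  Conversely, if \<open>h\<close> is in the closure of the class of \<open>f\<close>, then the continuous map
  \<open>g \<mapsto> h g\<inverse>\<close>, up to homotopy the heap operation with a constant third loop, shows that
  \<open>h h\<inverse>\<close> is in the closure of the class of \<open>h f\<inverse>\<close>, so \<open>h f\<inverse>\<close> is close to the null-homotopic
  loop \<open>h h\<inverse>\<close>. If only the trivial class has this property, then \<open>[h] = [f]\<close>; hence the homotopy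
  classes are closed sets of loops, and points are closed in the quotient.
\<close>

section \<open>The loop space\<close>

lemma image_restrict_subset: "B \<subseteq> A \<Longrightarrow> restrict f A ` B = f ` B"
  by (intro image_cong) auto

lemma restrict_in_loop_space:
  assumes "f \<in> loops_at S x"
  shows "restrict f {0..1} \<in> topspace (loop_space S x)"
    and "homotopic_paths S f (restrict f {0..1})"
proof -
  show h: "homotopic_paths S f (restrict f {0..1})"
    using assms by (intro homotopic_paths_eq) (auto simp: loops_at_def)
  show "restrict f {0..1} \<in> topspace (loop_space S x)"
    using assms homotopic_paths_imp_path[OF h] homotopic_paths_imp_subset[OF h]
    by (auto simp: topspace_loop_space loops_at_def pathstart_def pathfinish_def)
qed

lemma path_class_restrict:
  "f \<in> loops_at S x \<Longrightarrow> path_class S (restrict f {0..1}) = path_class S f"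
  using path_class_eqI[OF restrict_in_loop_space(2)] by metis

lemma openin_loop_space_subbasic:
  assumes "compact K" "K \<subseteq> {0..1}" "openin (top_of_set S) U"
  shows "openin (loop_space S x) {g \<in> topspace (loop_space S x). g ` K \<subseteq> U}"
proof -
  let ?B = "{f \<in> extensional (topspace (top_of_set {0..1})).
    continuous_map (top_of_set {0..1}) (top_of_set S) f \<and> f ` K \<subseteq> U}"
  have "openin (compact_open_topology (top_of_set {0..1}) (top_of_set S)) ?B"
    unfolding compact_open_topology_def using assms
    by (intro topology_generated_by_Basis) (auto simp: compactin_subtopology)
  moreover have "{g \<in> topspace (loop_space S x). g ` K \<subseteq> U} = ?B \<inter> loops_at S x"
    by (auto simp: topspace_loop_space loops_at_def path_def path_image_def)
  ultimately show ?thesis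
    unfolding loop_space_def openin_subtopology by blast
qed

lemma openin_loop_space_finite:
  assumes "finite I" "\<And>i. i \<in> I \<Longrightarrow> compact (K i) \<and> K i \<subseteq> {0..1} \<and> openin (top_of_set S) (U i)"
  shows "openin (loop_space S x) {g \<in> topspace (loop_space S x). \<forall>i\<in>I. g ` K i \<subseteq> U i}"
proof -
  have "openin (loop_space S x) ((\<Inter>i\<in>I. {g \<in> topspace (loop_space S x). g ` K i \<subseteq> U i}) \<inter>
      topspace (loop_space S x))"
    using assms by (intro openin_INT openin_loop_space_subbasic) auto
  also have "(\<Inter>i\<in>I. {g \<in> topspace (loop_space S x). g ` K i \<subseteq> U i}) \<inter> topspace (loop_space S x) =
      {g \<in> topspace (loop_space S x). \<forall>i\<in>I. g ` K i \<subseteq> U i}"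
    by auto
  finally show ?thesis .
qed

text \<open>
  Preimages of the subbasic sets suffice, because they generate the compact-open topology.
\<close>

lemma continuous_map_into_loop_space:
  assumes im: "\<And>z. z \<in> topspace Z \<Longrightarrow> \<Phi> z \<in> topspace (loop_space S x)"
    and op: "\<And>K U. \<lbrakk>compact K; K \<subseteq> {0..1}; openin (top_of_set S) U\<rbrakk>
      \<Longrightarrow> openin Z {z \<in> topspace Z. \<Phi> z ` K \<subseteq> U}"
  shows "continuous_map Z (loop_space S x) \<Phi>"
  unfolding loop_space_def continuous_map_in_subtopology
proof
  show "\<Phi> \<in> topspace Z \<rightarrow> loops_at S x"
    using im by (auto simp: topspace_loop_space)
  have cm: "\<Phi> z \<in> extensional {0..1} \<and> continuous_map (top_of_set {0..1}) (top_of_set S) (\<Phi> z)"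
    if "z \<in> topspace Z" for z
    using im[OF that] by (auto simp: topspace_loop_space loops_at_def path_def path_image_def)
  show "continuous_map Z (compact_open_topology (top_of_set {0..1}) (top_of_set S)) \<Phi>"
    unfolding compact_open_topology_def
  proof (rule continuous_on_generated_topo)
    fix B assume "B \<in> {{f \<in> extensional (topspace (top_of_set {0..1})).
        continuous_map (top_of_set {0..1}) (top_of_set S) f \<and> f ` K \<subseteq> U} |K U.
        compactin (top_of_set {0..1::real}) K \<and> openin (top_of_set S) U}"
    then obtain K U where KU: "compact K" "K \<subseteq> {0..1}" "openin (top_of_set S) U"
      and B: "B = {f \<in> extensional {0..1}.
        continuous_map (top_of_set {0..1}) (top_of_set S) f \<and> f ` K \<subseteq> U}"
      by (auto simp: compactin_subtopology)
    have "\<Phi> -` B \<inter> topspace Z = {z \<in> topspace Z. \<Phi> z ` K \<subseteq> U}"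
      using cm unfolding B by blast
    then show "openin Z (\<Phi> -` B \<inter> topspace Z)"
      using op[OF KU] by simp
  next
    have "\<Phi> z \<in> topspace (compact_open_topology (top_of_set {0..1}) (top_of_set S))"
      if "z \<in> topspace Z" for z
      using cm[OF that] by (simp add: topspace_compact_open_topology)
    then show "\<Phi> ` topspace Z \<subseteq> \<Union> {{f \<in> extensional (topspace (top_of_set {0..1})).
        continuous_map (top_of_set {0..1}) (top_of_set S) f \<and> f ` K \<subseteq> U} |K U.
        compactin (top_of_set {0..1::real}) K \<and> openin (top_of_set S) U}"
      unfolding compact_open_topology_def topology_generated_by_topspace by blast
  qed
qed

section \<open>Continuity of the heap operation on loops\<close>

text \<open>
  This is the heap operation \<open>f g\<inverse> h\<close> of the fundamental group, lifted to loops and taken as a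
  function of the middle argument. Since \<open>f f\<inverse> h = h\<close> and \<open>f h\<inverse> h = f\<close>, it exchanges the classes of
  \<open>f\<close> and \<open>h\<close>, so that this one map does the work of inversion and both translations. The
  restriction makes the value a point of the loop space, whose elements are extensional.
\<close>

definition heap_op :: "(real \<Rightarrow> 'a::topological_space) \<Rightarrow> (real \<Rightarrow> 'a) \<Rightarrow> (real \<Rightarrow> 'a) \<Rightarrow> real \<Rightarrow> 'a" where
  "heap_op f h g = restrict (f +++ (reversepath g +++ h)) {0..1}"

lemma heap_op_loop:
  assumes "f \<in> loops_at S x" "g \<in> loops_at S x" "h \<in> loops_at S x"
  shows "f +++ (reversepath g +++ h) \<in> loops_at S x"
  by (intro join_in_loops_at reversepath_in_loops_at assms)

lemma heap_op_in_loop_space: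
  assumes "f \<in> loops_at S x" "g \<in> loops_at S x" "h \<in> loops_at S x"
  shows "heap_op f h g \<in> topspace (loop_space S x)"
  unfolding heap_op_def by (intro restrict_in_loop_space heap_op_loop assms)

lemma path_class_reversepath:
  assumes "x \<in> S" "g \<in> loops_at S x"
  shows "path_class S (reversepath g) = inv\<^bsub>fundamental_group S x\<^esub> (path_class S g)"
proof -
  interpret group "fundamental_group S x" by (rule group_fundamental_group[OF assms(1)])
  have "path_class S (reversepath g) \<otimes>\<^bsub>fundamental_group S x\<^esub> path_class S g = \<one>\<^bsub>fundamental_group S x\<^esub>"
    using homotopic_reversepath_join[OF assms(2)] assms(2)
    by (simp add: fundamental_group_mult reversepath_in_loops_at path_class_eqI)
      (simp add: fundamental_group_def path_class_eqI)
  then show ?thesis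
    using assms(2) by (intro inv_equality[symmetric])
      (auto simp: fundamental_group_def reversepath_in_loops_at)
qed

lemma path_class_heap_op:
  assumes "x \<in> S" "f \<in> loops_at S x" "g \<in> loops_at S x" "h \<in> loops_at S x"
  shows "path_class S (heap_op f h g) = path_class S f \<otimes>\<^bsub>fundamental_group S x\<^esub>
    (inv\<^bsub>fundamental_group S x\<^esub> (path_class S g) \<otimes>\<^bsub>fundamental_group S x\<^esub> path_class S h)"
  unfolding heap_op_def
  using assms by (simp add: path_class_restrict[OF heap_op_loop] fundamental_group_mult
      join_in_loops_at reversepath_in_loops_at flip: path_class_reversepath)

text \<open>
  At each time the path \<open>f g\<inverse> h\<close> either reads the middle loop, at an affinely rescaled time, or does
  not depend on it. Hence a constraint to send a compact set \<open>K\<close> into \<open>U\<close> turns into the same kind of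
  constraint on \<open>g\<close>, on the rescaled part of \<open>K\<close> lying in \<open>[1/2, 3/4]\<close>, together with a condition
  that holds for all \<open>g\<close> or for none.
\<close>

lemma continuous_map_heap_op:
  assumes f: "f \<in> loops_at S x" and h: "h \<in> loops_at S x"
  shows "continuous_map (loop_space S x) (loop_space S x) (heap_op f h)"
proof (rule continuous_map_into_loop_space)
  fix g assume "g \<in> topspace (loop_space S x)"
  then show "heap_op f h g \<in> topspace (loop_space S x)"
    using f h by (intro heap_op_in_loop_space) (auto simp: topspace_loop_space)
next
  fix K U assume K: "compact K" "K \<subseteq> {0..1::real}" and U: "openin (top_of_set S) U"
  define \<sigma> :: "real \<Rightarrow> real" where "\<sigma> s = 3 - 4 * s" for s
  define c where "c s = (if s \<le> 1/2 then f (2 * s) else h (4 * s - 3))" for s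
  let ?M = "{1/2..3/4::real}"
  have eq: "heap_op f h g s = (if s \<in> ?M then g (\<sigma> s) else c s)"
    if "g \<in> loops_at S x" "s \<in> {0..1}" for g s
  proof -
    have e: "f 1 = x" "g 1 = x"
      using f that by (auto simp: loops_at_def pathfinish_def)
    consider "s < 1/2" | "s = 1/2" | "1/2 < s" "s \<le> 3/4" | "3/4 < s"
      by linarith
    then show ?thesis
    proof cases
      case 2
      then have "2 * s = 1" "\<sigma> s = 1" "s \<in> ?M" by (simp_all add: \<sigma>_def)
      with 2 that e show ?thesis by (simp add: heap_op_def joinpaths_def)
    next
      case 4
      then have "2 * (2 * s - 1) - 1 = 4 * s - 3" by simp
      with 4 that show ?thesis
        by (simp add: heap_op_def joinpaths_def c_def)
    next
      case 3
      then have "1 - 2 * (2 * s - 1) = 3 - 4 * s" by simp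
      with 3 that show ?thesis
        by (simp add: heap_op_def joinpaths_def \<sigma>_def reversepath_def)
    qed (use that in \<open>auto simp: heap_op_def joinpaths_def c_def\<close>)
  qed
  let ?L = "\<sigma> ` (K \<inter> ?M)"
  have iff: "heap_op f h g ` K \<subseteq> U \<longleftrightarrow> g ` ?L \<subseteq> U \<and> c ` (K - ?M) \<subseteq> U"
    if "g \<in> topspace (loop_space S x)" for g
  proof -
    have g: "g \<in> loops_at S x" using that by (simp add: topspace_loop_space)
    have "heap_op f h g ` K = (\<lambda>s. if s \<in> ?M then g (\<sigma> s) else c s) ` K"
      using eq[OF g] K(2) by (intro image_cong) auto
    also have "\<dots> = (\<lambda>s. if s \<in> ?M then g (\<sigma> s) else c s) ` (K \<inter> ?M) \<union>
        (\<lambda>s. if s \<in> ?M then g (\<sigma> s) else c s) ` (K - ?M)"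
      by (simp only: Int_Diff_Un flip: image_Un)
    also have "\<dots> = g ` ?L \<union> c ` (K - ?M)"
      unfolding image_image by (intro arg_cong2[where f = "(\<union>)"] image_cong) auto
    finally show ?thesis by simp
  qed
  have "compact ?L"
    unfolding \<sigma>_def using K by (intro compact_continuous_image continuous_intros compact_Int) auto
  moreover have "?L \<subseteq> {0..1}"
    by (auto simp: \<sigma>_def)
  ultimately have "openin (loop_space S x) {g \<in> topspace (loop_space S x). g ` ?L \<subseteq> U}"
    using U by (rule openin_loop_space_subbasic)
  moreover have eqn: "{g \<in> topspace (loop_space S x). heap_op f h g ` K \<subseteq> U} =
      {g \<in> topspace (loop_space S x). g ` ?L \<subseteq> U \<and> c ` (K - ?M) \<subseteq> U}"
    by (intro Collect_cong conj_cong refl iff)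
  ultimately show "openin (loop_space S x) {g \<in> topspace (loop_space S x). heap_op f h g ` K \<subseteq> U}"
    unfolding eqn by (cases "c ` (K - ?M) \<subseteq> U") (simp_all only: simp_thms empty_def[symmetric] openin_empty)
qed

section \<open>Neighbourhoods given by partitions\<close>

definition subordinate :: "nat \<Rightarrow> (nat \<Rightarrow> real) \<Rightarrow> (nat \<Rightarrow> 'a set) \<Rightarrow> (real \<Rightarrow> 'a) set" where
  "subordinate n t U = {\<gamma>. \<forall>i\<in>{1..n}. \<gamma> ` {t (i - 1)..t i} \<subseteq> U i}"

text \<open>
  Each subbasic condition \<open>g ` K \<subseteq> U\<close> is implied by a condition along the uniform partition once
  the mesh is below the distance from \<open>K\<close> to the complement of \<open>g -` U\<close>: intervals
  that meet \<open>K\<close> must go into \<open>U\<close>, and the others are free. Asking for all large \<open>N\<close> rather than for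
  some partition avoids common refinements: for a finite intersection of conditions the same \<open>N\<close>
  serves all of them.
\<close>

lemma eventually_subordinate_nhd:
  fixes S :: "'a::topological_space set"
  assumes "openin (loop_space S x) T" and "g \<in> T"
  shows "\<forall>\<^sub>F N in sequentially. \<exists>U. (\<forall>i\<in>{1..N}. openin (top_of_set S) (U i)) \<and>
    g \<in> subordinate N (\<lambda>i. i / N) U \<and>
    topspace (loop_space S x) \<inter> subordinate N (\<lambda>i. i / N) U \<subseteq> T"
proof -
  let ?\<B> = "{{f \<in> extensional (topspace (top_of_set {0..1})).
        continuous_map (top_of_set {0..1}) (top_of_set S) f \<and> f ` K \<subseteq> U} |K U.
        compactin (top_of_set {0..1::real}) K \<and> openin (top_of_set S) U}"
  let ?top = "topspace (loop_space S x)"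
  obtain W where W: "generate_topology_on ?\<B> W" and T: "T = W \<inter> loops_at S x"
    using assms(1) unfolding loop_space_def compact_open_topology_def openin_subtopology
      openin_topology_generated_by_iff by blast
  have g: "g \<in> ?top" "g \<in> W"
    using assms T openin_subset[OF assms(1)] by auto
  have "\<forall>\<^sub>F N in sequentially. \<exists>U. (\<forall>i\<in>{1..N}. openin (top_of_set S) (U i)) \<and>
    g \<in> subordinate N (\<lambda>i. i / N) U \<and> ?top \<inter> subordinate N (\<lambda>i. i / N) U \<subseteq> W"
    using W g(2)
  proof induction
    case Empty
    then show ?case by simp
  next
    case (UN \<K>)
    then obtain k where "k \<in> \<K>" "g \<in> k" by blast
    from UN.IH[OF this] show ?case
      by (rule eventually_mono) (use \<open>k \<in> \<K>\<close> in blast)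
  next
    case (Int a b)
    then have "g \<in> a" "g \<in> b" by auto
    from eventually_conj[OF Int.IH(1)[OF this(1)] Int.IH(2)[OF this(2)]] show ?case
    proof (rule eventually_mono, elim conjE exE)
      fix N :: nat and U V :: "nat \<Rightarrow> 'a set"
      have "subordinate N (\<lambda>i. i / N) (\<lambda>i. U i \<inter> V i) =
          subordinate N (\<lambda>i. i / N) U \<inter> subordinate N (\<lambda>i. i / N) V"
        unfolding subordinate_def by blast
      moreover assume "\<forall>i\<in>{1..N}. openin (top_of_set S) (U i)" "\<forall>i\<in>{1..N}. openin (top_of_set S) (V i)"
        "g \<in> subordinate N (\<lambda>i. i / N) U" "?top \<inter> subordinate N (\<lambda>i. i / N) U \<subseteq> a"
        "g \<in> subordinate N (\<lambda>i. i / N) V" "?top \<inter> subordinate N (\<lambda>i. i / N) V \<subseteq> b"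
      ultimately show "\<exists>U. (\<forall>i\<in>{1..N}. openin (top_of_set S) (U i)) \<and>
          g \<in> subordinate N (\<lambda>i. i / N) U \<and> ?top \<inter> subordinate N (\<lambda>i. i / N) U \<subseteq> a \<inter> b"
        by (intro exI[of _ "\<lambda>i. U i \<inter> V i"]) auto
    qed
  next
    case (Basis B)
    then obtain K U where K: "compact K" "K \<subseteq> {0..1}" and U: "openin (top_of_set S) U"
      and B: "B = {f \<in> extensional {0..1}.
        continuous_map (top_of_set {0..1}) (top_of_set S) f \<and> f ` K \<subseteq> U}"
      by (auto simp: compactin_subtopology)
    have gU: "g ` K \<subseteq> U" and gS: "g ` {0..1} \<subseteq> S" and cg: "continuous_on {0..1} g"
      using Basis(2) g(1) by (auto simp: B)
    have "openin (top_of_set {0..1}) ({0..1} \<inter> g -` U)"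
      using cg gS U by (intro continuous_openin_preimage) auto
    then obtain V where V: "open V" "{0..1} \<inter> g -` U = {0..1} \<inter> V"
      by (auto simp: openin_open)
    then have "K \<subseteq> V" using gU K(2) by blast
    then obtain e where e: "e > 0" "(\<Union>s\<in>K. cball s e) \<subseteq> V"
      using compact_subset_open_imp_cball_epsilon_subset[OF K(1) V(1)] by metis
    have "\<forall>\<^sub>F N in sequentially. inverse (real N) < e"
      using LIMSEQ_inverse_real_of_nat e(1) lim_inverse_n by (intro order_tendstoD) auto
    moreover have "\<forall>\<^sub>F N in sequentially. N > (0::nat)" by (rule eventually_gt_at_top)
    ultimately show ?case
    proof eventually_elim
      case (elim N)
      let ?I = "\<lambda>i::nat. {real (i - 1) / N..i / N}"
      define U' where "U' i = (if ?I i \<inter> K \<noteq> {} then U else S)" for i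
      have len: "real i / N = real (i - 1) / N + inverse N" if "i \<in> {1..N}" for i
        using that elim by (simp add: field_simps of_nat_diff)
      have sub: "?I i \<subseteq> {0..1}" if "i \<in> {1..N}" for i
        using that elim by (auto simp: field_simps intro: order_trans)
      have "g ` ?I i \<subseteq> U' i" if i: "i \<in> {1..N}" for i
      proof (cases "?I i \<inter> K = {}")
        case True
        then show ?thesis
          using image_mono[OF sub[OF i], of g] gS by (simp add: U'_def del: image_subset_iff)
      next
        case False
        then obtain k where k: "k \<in> K" "k \<in> ?I i" by blast
        have "s \<in> cball k e" if "s \<in> ?I i" for s
          using that k(2) len[OF i] elim by (auto simp: dist_real_def)
        then have "?I i \<subseteq> V" using e(2) k(1) by blast
        then have "?I i \<subseteq> {0..1} \<inter> g -` U" using V(2) sub[OF i] by blast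
        then have "g ` ?I i \<subseteq> U" by blast
        then show ?thesis using False by (simp add: U'_def del: image_subset_iff)
      qed
      moreover have "\<gamma> \<in> B" if \<gamma>: "\<gamma> \<in> ?top" "\<gamma> \<in> subordinate N (\<lambda>i. i / N) U'" for \<gamma>
      proof -
        have "\<gamma> s \<in> U" if s: "s \<in> K" for s
        proof -
          \<comment> \<open>The maximum with 1 covers \<open>s = 0\<close>, which belongs to the first interval.\<close>
          define i where "i = max 1 (nat \<lceil>s * N\<rceil>)"
          have s01: "0 \<le> s" "s \<le> 1" using s K(2) by auto
          have "s * N \<le> N" using s01 by (simp add: mult_left_le_one_le)
          then have i: "i \<in> {1..N}" using elim by (auto simp: i_def ceiling_le_iff)
          have "s * N \<le> i" "real (i - 1) \<le> s * N"
            using s01 elim by (auto simp: i_def max_def not_le; linarith)+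
          then have "s \<in> ?I i" using elim by (auto simp: field_simps)
          moreover from this have "U' i = U" using s by (auto simp: U'_def)
          moreover have "\<gamma> ` ?I i \<subseteq> U' i"
            using \<gamma>(2) i by (simp add: subordinate_def)
          ultimately show ?thesis by blast
        qed
        then show ?thesis
          using \<gamma>(1) by (auto simp: B topspace_loop_space loops_at_def path_def path_image_def)
      qed
      ultimately show ?case
        using U by (intro exI[of _ U']) (auto simp: subordinate_def U'_def)
    qed
  qed
  then show ?thesis
    by (rule eventually_mono) (auto simp: T topspace_loop_space)
qed

section \<open>Moving a path through prescribed points\<close>

text \<open>
  The new path follows \<open>\<delta>\<close> until it reaches \<open>\<delta> \<tau>\<close>, runs backwards along \<open>l\<close> to its start, which it
  meets at time \<open>\<tau>\<close>, returns along \<open>l\<close> and continues along \<open>\<delta>\<close>. Retracting the excursion along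
  \<open>l\<close> leaves a reparametrization of \<open>\<delta>\<close>. Everything happens between \<open>a\<close> and \<open>b\<close>.
  On either side of \<open>\<tau>\<close> only \<open>l\<close> and values of \<open>\<delta>\<close> from the same side occur, so conditions
  along a partition containing \<open>a\<close>, \<open>\<tau>\<close> and \<open>b\<close> survive if \<open>l\<close> obeys the conditions on both sides.
\<close>

lemma homotopic_spike:
  fixes \<delta> :: "real \<Rightarrow> 'a::topological_space"
  assumes \<delta>: "path \<delta>" "path_image \<delta> \<subseteq> S"
    and ab: "0 \<le> a" "a < \<tau>" "\<tau> < b" "b \<le> 1"
    and l: "path l" "path_image l \<subseteq> S" "pathfinish l = \<delta> \<tau>"
  obtains \<gamma> where "homotopic_paths S \<gamma> \<delta>" "\<gamma> \<tau> = pathstart l"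
    "\<And>s. s \<le> a \<or> b \<le> s \<Longrightarrow> \<gamma> s = \<delta> s"
    "\<gamma> ` {a..\<tau>} \<subseteq> \<delta> ` {a..\<tau>} \<union> path_image l"
    "\<gamma> ` {\<tau>..b} \<subseteq> \<delta> ` {\<tau>..b} \<union> path_image l"
proof -
  define \<epsilon> where "\<epsilon> = min (\<tau> - a) (b - \<tau>) / 2"
  have \<epsilon>: "\<epsilon> > 0" "a \<le> \<tau> - 2 * \<epsilon>" "\<tau> + 2 * \<epsilon> \<le> b"
    using ab by (auto simp: \<epsilon>_def)
  \<comment> \<open>\<open>r\<close> waits at \<open>\<tau>\<close> for all times within \<open>\<epsilon>\<close> of \<open>\<tau>\<close>, catches up at double speed, and is the identity
    at distance \<open>2 * \<epsilon>\<close> or more; \<open>P\<close> is its right half, shifted to the origin.\<close>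
  define P where "P y = min (max 0 y) (max 0 (2 * y - 2 * \<epsilon>))" for y
  define r where "r s = \<tau> + P (s - \<tau>) - P (\<tau> - s)" for s
  have r_flat: "r s = \<tau>" if "\<bar>s - \<tau>\<bar> \<le> \<epsilon>" for s
    using that \<epsilon>(1) by (auto simp: r_def P_def min_def max_def)
  have r_id: "r s = s" if "2 * \<epsilon> \<le> \<bar>s - \<tau>\<bar>" for s
    using that \<epsilon>(1) by (auto simp: r_def P_def min_def max_def)
  have r_between: "min s \<tau> \<le> r s" "r s \<le> max s \<tau>" for s
    using \<epsilon>(1) by (auto simp: r_def P_def min_def max_def)
  have r01: "r s \<in> {0..1}" if "s \<in> {0..1}" for s
    using r_between[of s] that ab by (auto simp: min_def max_def split: if_splits)
  have r_cont: "continuous_on A r" for A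
    unfolding r_def P_def by (intro continuous_intros)
  define w where "w z = fst z + (1 - fst z) * (\<bar>snd z - \<tau>\<bar> / \<epsilon>)" for z :: "real \<times> real"
  have w01: "w z \<in> {0..1}" if "fst z \<in> {0..1}" "\<bar>snd z - \<tau>\<bar> \<le> \<epsilon>" for z
  proof -
    let ?v = "\<bar>snd z - \<tau>\<bar> / \<epsilon>"
    have "0 \<le> ?v" "?v \<le> 1" using that \<epsilon>(1) by auto
    then have "0 \<le> (1 - fst z) * ?v" "(1 - fst z) * ?v \<le> (1 - fst z) * 1"
      using that(1) by (intro mult_nonneg_nonneg mult_left_mono; simp)+
    then show ?thesis using that(1) unfolding w_def by auto
  qed
  \<comment> \<open>\<open>fst z\<close> is the homotopy parameter: at 0 the whole of \<open>l\<close> is traversed, at 1 only its endpoint.\<close>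
  define H where "H z = (if \<bar>snd z - \<tau>\<bar> \<le> \<epsilon> then l (w z) else \<delta> (r (snd z)))" for z
  have c\<delta>: "continuous_on {0..1} \<delta>" and cl: "continuous_on {0..1} l"
    using \<delta> l by (auto simp: path_def)
  have "continuous_on ({0..1} \<times> {0..1}) H"
    unfolding H_def
  proof (rule continuous_on_cases_le)
    show "continuous_on {z \<in> {0..1} \<times> {0..1}. \<bar>snd z - \<tau>\<bar> \<le> \<epsilon>} (\<lambda>z. l (w z))"
    proof (rule continuous_on_compose2[OF cl])
      show "continuous_on {z \<in> {0..1} \<times> {0..1}. \<bar>snd z - \<tau>\<bar> \<le> \<epsilon>} w"
        unfolding w_def using \<epsilon>(1) by (intro continuous_intros) auto
    qed (use w01 in fastforce)
    show "continuous_on {z \<in> {0..1} \<times> {0..1}. \<epsilon> \<le> \<bar>snd z - \<tau>\<bar>} (\<lambda>z. \<delta> (r (snd z)))"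
    proof (rule continuous_on_compose2[OF c\<delta>])
      show "continuous_on {z \<in> {0..1} \<times> {0..1}. \<epsilon> \<le> \<bar>snd z - \<tau>\<bar>} (\<lambda>z. r (snd z))"
        by (rule continuous_on_compose2[OF r_cont[of UNIV]]) (auto intro!: continuous_intros)
    qed (use r01 in fastforce)
    show "continuous_on ({0..1} \<times> {0..1}) (\<lambda>z::real\<times>real. \<bar>snd z - \<tau>\<bar>)"
      by (intro continuous_intros)
    fix z :: "real \<times> real" assume "\<bar>snd z - \<tau>\<bar> = \<epsilon>"
    then show "l (w z) = \<delta> (r (snd z))"
      using \<epsilon>(1) l(3) by (simp add: w_def r_flat pathfinish_def)
  qed
  moreover have H_image: "H (u, s) \<in> insert (\<delta> (r s)) (path_image l)" if "u \<in> {0..1}" for u s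
    using w01[of "(u, s)"] that by (auto simp: H_def path_image_def)
  moreover have H_out: "H (u, s) = \<delta> s" if "s \<le> a \<or> b \<le> s" for u s
    using that \<epsilon> by (auto simp: H_def r_id)
  moreover have "H (1, s) = \<delta> (r s)" for s
    using l(3) by (simp add: H_def w_def r_flat pathfinish_def)
  moreover have "\<delta> (r s) \<in> S" if "s \<in> {0..1}" for s
    using r01[OF that] \<delta>(2) by (auto simp: path_image_def)
  ultimately have "homotopic_paths S (\<lambda>s. H (0, s)) (\<lambda>s. \<delta> (r s))"
    unfolding homotopic_paths using ab l(2)
    by (intro exI[of _ H]) (auto simp: pathstart_def pathfinish_def subset_iff, metis H_image insertE atLeastAtMost_iff)
  moreover have "homotopic_paths S \<delta> (\<lambda>s. \<delta> (r s))"
    using ab \<epsilon> r01 by (intro homotopic_paths_reparametrize[OF \<delta> r_cont]) (auto simp: r_id)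
  ultimately have "homotopic_paths S (\<lambda>s. H (0, s)) \<delta>"
    using homotopic_paths_trans homotopic_paths_sym by blast
  moreover have "H (0, \<tau>) = pathstart l"
    using \<epsilon>(1) by (simp add: H_def w_def pathstart_def)
  moreover have "H (0, s) \<in> \<delta> ` {a..\<tau>} \<union> path_image l" if "s \<in> {a..\<tau>}" for s
    using H_image[of 0 s] r_between[of s] that by auto
  moreover have "H (0, s) \<in> \<delta> ` {\<tau>..b} \<union> path_image l" if "s \<in> {\<tau>..b}" for s
    using H_image[of 0 s] r_between[of s] that by auto
  ultimately show ?thesis
    using H_out by (intro that[of "\<lambda>s. H (0, s)"]) blast+
qed

lemma partition_mono:
  fixes t :: "nat \<Rightarrow> real"
  assumes "\<forall>i<n. t i < t (Suc i)" "i \<le> j" "j \<le> n"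
  shows "t i \<le> t j"
  using assms(2,3)
proof (induction j rule: dec_induct)
  case (step m)
  then have "t m < t (Suc m)" "t i \<le> t m" using assms(1) by auto
  then show ?case by simp
qed simp

text \<open>
  The interior partition points are treated one after the other by inserting a spike. The spike at
  \<open>t i\<close> runs in \<open>U i \<inter> U (Suc i)\<close> and leaves the path unchanged at all other partition points.
\<close>

lemma homotopic_through_points:
  assumes t: "t 0 = 0" "t n = 1" "\<forall>i<n. t i < t (Suc i)"
    and \<delta>: "path \<delta>" "path_image \<delta> \<subseteq> S" "\<delta> \<in> subordinate n t U"
    and conn: "\<And>i. i \<in> {1..<n} \<Longrightarrow> \<exists>l. path l \<and> path_image l \<subseteq> S \<inter> U i \<inter> U (Suc i) \<and>
      pathstart l = p i \<and> pathfinish l = \<delta> (t i)"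
  shows "\<exists>\<gamma>. homotopic_paths S \<gamma> \<delta> \<and> \<gamma> \<in> subordinate n t U \<and> (\<forall>i\<in>{1..<n}. \<gamma> (t i) = p i)"
proof -
  note mono = partition_mono[OF t(3)]
  have "\<exists>\<gamma>. homotopic_paths S \<gamma> \<delta> \<and> \<gamma> \<in> subordinate n t U \<and>
      (\<forall>i\<in>{1..k}. \<gamma> (t i) = p i) \<and> (\<forall>i\<in>{Suc k..<n}. \<gamma> (t i) = \<delta> (t i))" if "k < n" for k
    using that
  proof (induction k)
    case 0
    then show ?case using \<delta> by (intro exI[of _ \<delta>]) auto
  next
    case (Suc k)
    obtain \<gamma> where \<gamma>: "homotopic_paths S \<gamma> \<delta>" "\<gamma> \<in> subordinate n t U"
      "\<And>i. i \<in> {1..k} \<Longrightarrow> \<gamma> (t i) = p i" "\<And>i. i \<in> {Suc k..<n} \<Longrightarrow> \<gamma> (t i) = \<delta> (t i)"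
      using Suc.IH[OF Suc_lessD[OF Suc.prems]] by blast
    obtain l where l: "path l" "path_image l \<subseteq> S \<inter> U (Suc k) \<inter> U (Suc (Suc k))"
      "pathstart l = p (Suc k)" "pathfinish l = \<gamma> (t (Suc k))"
      using conn[of "Suc k"] \<gamma>(4)[of "Suc k"] Suc.prems by (auto simp del: le_inf_iff)
    have ab: "0 \<le> t k" "t k < t (Suc k)" "t (Suc k) < t (Suc (Suc k))" "t (Suc (Suc k)) \<le> 1"
      using mono[of 0 k] mono[of "Suc (Suc k)" n] t(1,2) spec[OF t(3), of k] spec[OF t(3), of "Suc k"] Suc.prems
      by simp_all
    have p\<gamma>: "path \<gamma>" "path_image \<gamma> \<subseteq> S"
      using homotopic_paths_imp_path[OF \<gamma>(1)] homotopic_paths_imp_subset[OF \<gamma>(1)] by auto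
    have lS: "path_image l \<subseteq> S" using l(2) by auto
    obtain \<gamma>' where \<gamma>': "homotopic_paths S \<gamma>' \<gamma>" "\<gamma>' (t (Suc k)) = p (Suc k)"
      "\<And>s. s \<le> t k \<or> t (Suc (Suc k)) \<le> s \<Longrightarrow> \<gamma>' s = \<gamma> s"
      "\<gamma>' ` {t k..t (Suc k)} \<subseteq> \<gamma> ` {t k..t (Suc k)} \<union> path_image l"
      "\<gamma>' ` {t (Suc k)..t (Suc (Suc k))} \<subseteq> \<gamma> ` {t (Suc k)..t (Suc (Suc k))} \<union> path_image l"
      by (rule homotopic_spike[OF p\<gamma> ab l(1) lS l(4)]) (rule that, simp_all only: l(3))
    have \<gamma>U: "\<gamma> ` {t (i - 1)..t i} \<subseteq> U i" if "i \<in> {1..n}" for i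
      using \<gamma>(2) that unfolding subordinate_def by blast
    have "\<gamma>' ` {t (i - 1)..t i} \<subseteq> U i" if i: "i \<in> {1..n}" for i
    proof -
      consider "i \<le> k" | "i = Suc k" | "i = Suc (Suc k)" | "Suc (Suc k) \<le> i - 1"
        by linarith
      then show ?thesis
      proof cases
        case 1
        then have "t i \<le> t k" using mono Suc.prems by simp
        then have "\<gamma>' ` {t (i - 1)..t i} = \<gamma> ` {t (i - 1)..t i}"
          by (intro image_cong refl \<gamma>'(3)) auto
        then show ?thesis using \<gamma>U[OF i] by simp
      next
        case 2
        have "\<gamma> ` {t (i - 1)..t i} \<union> path_image l \<subseteq> U i"
          using \<gamma>U[OF i] l(2) 2 by (intro Un_least) auto
        with \<gamma>'(4) show ?thesis unfolding 2 diff_Suc_1 by (rule order_trans)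
      next
        case 3
        have "\<gamma> ` {t (i - 1)..t i} \<union> path_image l \<subseteq> U i"
          using \<gamma>U[OF i] l(2) 3 by (intro Un_least) auto
        with \<gamma>'(5) show ?thesis unfolding 3 diff_Suc_1 by (rule order_trans)
      next
        case 4
        then have "t (Suc (Suc k)) \<le> t (i - 1)" using mono[of "Suc (Suc k)" "i - 1"] i by auto
        then have "\<gamma>' ` {t (i - 1)..t i} = \<gamma> ` {t (i - 1)..t i}"
          by (intro image_cong refl \<gamma>'(3)) auto
        then show ?thesis using \<gamma>U[OF i] by simp
      qed
    qed
    then have "\<gamma>' \<in> subordinate n t U" unfolding subordinate_def by blast
    moreover have "homotopic_paths S \<gamma>' \<delta>"
      using \<gamma>'(1) \<gamma>(1) by (rule homotopic_paths_trans)
    moreover have "\<gamma>' (t i) = p i" if "i \<in> {1..Suc k}" for i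
    proof (cases "i = Suc k")
      case False
      with that have "i \<in> {1..k}" by auto
      then show ?thesis
        using \<gamma>(3)[of i] \<gamma>'(3)[of "t i"] mono[of i k] Suc.prems by simp
    qed (simp add: \<gamma>'(2))
    moreover have "\<gamma>' (t i) = \<delta> (t i)" if "i \<in> {Suc (Suc k)..<n}" for i
      using \<gamma>(4)[of i] \<gamma>'(3)[of "t i"] mono[of "Suc (Suc k)" i] that by simp
    ultimately show ?case by (intro exI[of _ \<gamma>'] conjI ballI)
  qed
  from this[of "n - 1"] obtain \<gamma> where "homotopic_paths S \<gamma> \<delta>" "\<gamma> \<in> subordinate n t U"
    "\<forall>i\<in>{1..n - 1}. \<gamma> (t i) = p i"
    using t(1,2) by (cases n) auto
  moreover have "{1..<n} = {1..n - 1}" by auto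
  ultimately show ?thesis by auto
qed

section \<open>Closeness as membership in a closure\<close>

definition class_loops :: "'a::topological_space set \<Rightarrow> 'a \<Rightarrow> (real \<Rightarrow> 'a) \<Rightarrow> (real \<Rightarrow> 'a) set" where
  "class_loops S x f = {g \<in> topspace (loop_space S x). path_class S g = path_class S f}"

lemma homotopically_closeD:
  assumes "homotopically_close S f g" "t 0 = 0" "t n = 1" "\<forall>i<n. t i < t (Suc i)"
    and "\<forall>i\<in>{1..n}. openin (top_of_set S) (U i)" "g \<in> subordinate n t U"
  shows "\<exists>\<gamma>. homotopic_paths S \<gamma> f \<and> \<gamma> \<in> subordinate n t U"
proof -
  note close = assms(1)[unfolded homotopically_close_def, THEN conjunct2, THEN conjunct2,
      THEN conjunct2, THEN conjunct2, THEN conjunct2, THEN conjunct2,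
      THEN spec[of _ n], THEN spec[of _ t], THEN spec[of _ U], THEN mp]
  have "\<forall>i\<in>{1..n}. openin (top_of_set S) (U i) \<and> g ` {t (i - 1)..t i} \<subseteq> U i"
    using assms(5,6) unfolding subordinate_def by blast
  from close[OF conjI[OF assms(2) conjI[OF assms(3) conjI[OF assms(4) this]]]]
  show ?thesis unfolding subordinate_def by blast
qed

text \<open>
  Closeness offers a loop of the class of \<open>f\<close> in every partition neighbourhood of \<open>h\<close>, and these
  neighbourhoods are a base at \<open>h\<close>.
\<close>

lemma homotopically_close_imp_closure:
  assumes f: "f \<in> loops_at S x" and h: "h \<in> loops_at S x" and close: "homotopically_close S f h"
  shows "restrict h {0..1} \<in> loop_space S x closure_of class_loops S x f"
  unfolding in_closure_of
proof (intro conjI allI impI)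
  show "restrict h {0..1} \<in> topspace (loop_space S x)"
    by (rule restrict_in_loop_space[OF h])
  fix T assume "restrict h {0..1} \<in> T \<and> openin (loop_space S x) T"
  then have "restrict h {0..1} \<in> T" "openin (loop_space S x) T" by auto
  from eventually_conj[OF eventually_gt_at_top[of 0] eventually_subordinate_nhd[OF this(2,1)]]
  obtain N U where N: "N > (0::nat)" and U: "\<forall>i\<in>{1..N}. openin (top_of_set S) (U i)"
    and hU: "restrict h {0..1} \<in> subordinate N (\<lambda>i. i / N) U"
    and UT: "topspace (loop_space S x) \<inter> subordinate N (\<lambda>i. i / N) U \<subseteq> T"
    by (auto dest!: eventually_happens'[OF sequentially_bot])
  have sub: "{real (i - 1) / N..i / N} \<subseteq> {0..1}" if "i \<in> {1..N}" for i
    using that N by (auto simp: field_simps intro: order_trans)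
  have restr: "restrict g {0..1} \<in> subordinate N (\<lambda>i. i / N) U \<longleftrightarrow>
      g \<in> subordinate N (\<lambda>i. i / N) U" for g
  proof -
    have "restrict g {0..1} ` {real (i - 1) / N..i / N} = g ` {real (i - 1) / N..i / N}"
      if "i \<in> {1..N}" for i
      by (rule image_restrict_subset[OF sub[OF that]])
    then show ?thesis by (simp add: subordinate_def)
  qed
  have "\<forall>i<N. real i / N < real (Suc i) / N"
    using N by (simp add: divide_strict_right_mono)
  moreover have "h \<in> subordinate N (\<lambda>i. i / N) U" using hU restr by simp
  ultimately obtain \<gamma> where \<gamma>: "homotopic_paths S \<gamma> f" "\<gamma> \<in> subordinate N (\<lambda>i. i / N) U"
    using homotopically_closeD[OF close, of "\<lambda>i. i / N" N U] N U by auto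
  have "\<gamma> \<in> loops_at S x"
    using f homotopic_paths_imp_path[OF \<gamma>(1)] homotopic_paths_imp_subset[OF \<gamma>(1)]
      homotopic_paths_imp_pathstart[OF \<gamma>(1)] homotopic_paths_imp_pathfinish[OF \<gamma>(1)]
    by (simp add: loops_at_def)
  then have "restrict \<gamma> {0..1} \<in> class_loops S x f"
    using path_class_eqI[OF \<gamma>(1)]
    by (simp add: class_loops_def restrict_in_loop_space(1) path_class_restrict[of _ S x])
  moreover from this have "restrict \<gamma> {0..1} \<in> T"
    using UT restr[of \<gamma>] \<gamma>(2) by (auto simp: class_loops_def)
  ultimately show "\<exists>g. g \<in> class_loops S x f \<and> g \<in> T" by blast
qed

text \<open>
  The converse has to recover the values at the partition points. A loop in the class of \<open>f\<close> can be
  chosen near \<open>h\<close> at the points \<open>t i\<close> too, namely in path connected neighbourhoods \<open>W i\<close> of \<open>h (t i)\<close>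
  contained in \<open>U i \<inter> U (Suc i)\<close>; paths inside the \<open>W i\<close> then serve as the spikes that make the loop
  pass through the points \<open>h (t i)\<close>.
\<close>

lemma closure_imp_homotopically_close:
  assumes lpc: "locally path_connected S"
    and f: "f \<in> loops_at S x" and h: "h \<in> loops_at S x"
    and cl: "restrict h {0..1} \<in> loop_space S x closure_of class_loops S x f"
  shows "homotopically_close S f h"
  unfolding homotopically_close_def
proof (intro conjI allI impI)
  show "path f" "path_image f \<subseteq> S" "path h" "path_image h \<subseteq> S"
    "pathstart f = pathstart h" "pathfinish f = pathfinish h"
    using f h by (auto simp: loops_at_def)
  fix n t U
  assume "t 0 = 0 \<and> t n = 1 \<and> (\<forall>i<n. t i < t (Suc i)) \<and>
    (\<forall>i\<in>{1..n}. openin (top_of_set S) (U i) \<and> h ` {t (i - 1)..t i} \<subseteq> U i)"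
  note * = this
  have t: "t 0 = 0" "t n = 1" "\<forall>i<n. t i < t (Suc i)"
    by (rule *[THEN conjunct1], rule *[THEN conjunct2, THEN conjunct1],
        rule *[THEN conjunct2, THEN conjunct2, THEN conjunct1])
  have U: "openin (top_of_set S) (U i)" and hU: "h ` {t (i - 1)..t i} \<subseteq> U i" if "i \<in> {1..n}" for i
    using *[THEN conjunct2, THEN conjunct2, THEN conjunct2, THEN bspec, OF that] by (simp_all only:)
  note mono = partition_mono[OF t(3)]
  have t01: "t i \<in> {0..1}" if "i \<le> n" for i
    using mono[of 0 i] mono[of i n] t that by auto
  have nbhd: "\<exists>W. openin (top_of_set S) W \<and> path_connected W \<and> h (t i) \<in> W \<and> W \<subseteq> U i \<inter> U (Suc i)"
    if i: "i \<in> {1..<n}" for i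
  proof -
    have "openin (top_of_set S) (U i \<inter> U (Suc i))"
      using U i by (intro openin_Int) auto
    moreover have "t i \<in> {t (i - 1)..t i}" "t i \<in> {t (Suc i - 1)..t (Suc i)}"
      using i mono[of "i - 1" i] mono[of i "Suc i"] by auto
    then have "h (t i) \<in> U i \<inter> U (Suc i)"
      using subsetD[OF hU[of i] imageI] subsetD[OF hU[of "Suc i"] imageI] i by simp
    ultimately show ?thesis
      using lpc[unfolded locally_path_connected, rule_format, OF conjI] by blast
  qed
  have "\<exists>W. \<forall>i\<in>{1..<n}. openin (top_of_set S) (W i) \<and>
      path_connected (W i) \<and> h (t i) \<in> W i \<and> W i \<subseteq> U i \<inter> U (Suc i)"
    by (rule bchoice) (intro ballI nbhd)
  then obtain W where W': "\<forall>i\<in>{1..<n}. openin (top_of_set S) (W i) \<and>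
      path_connected (W i) \<and> h (t i) \<in> W i \<and> W i \<subseteq> U i \<inter> U (Suc i)" ..
  note W = bspec[OF W']
  let ?T1 = "{g \<in> topspace (loop_space S x). \<forall>i\<in>{1..n}. g ` {t (i - 1)..t i} \<subseteq> U i}"
  let ?T2 = "{g \<in> topspace (loop_space S x). \<forall>i\<in>{1..<n}. g ` {t i} \<subseteq> W i}"
  have sub: "{t (i - 1)..t i} \<subseteq> {0..1}" if "i \<in> {1..n}" for i
    using t01[of "i - 1"] t01[of i] that by auto
  have "openin (loop_space S x) ?T1"
    by (rule openin_loop_space_finite) (simp, intro conjI compact_Icc sub U)
  moreover have "openin (loop_space S x) ?T2"
  proof (rule openin_loop_space_finite)
    fix i assume "i \<in> {1..<n}"
    then show "compact {t i} \<and> {t i} \<subseteq> {0..1} \<and> openin (top_of_set S) (W i)"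
      using W[of i] t01[of i] by simp
  qed simp
  ultimately have "openin (loop_space S x) (?T1 \<inter> ?T2)"
    by (rule openin_Int)
  moreover have "restrict h {0..1} \<in> ?T1 \<inter> ?T2"
  proof (intro IntI CollectI conjI ballI restrict_in_loop_space(1)[OF h])
    show "restrict h {0..1} ` {t (i - 1)..t i} \<subseteq> U i" if "i \<in> {1..n}" for i
      unfolding image_restrict_subset[OF sub[OF that]] by (rule hU[OF that])
    show "restrict h {0..1} ` {t i} \<subseteq> W i" if "i \<in> {1..<n}" for i
      using W[OF that] t01[of i] that by simp
  qed
  ultimately have "\<exists>\<delta>. \<delta> \<in> class_loops S x f \<and> \<delta> \<in> ?T1 \<inter> ?T2"
    using cl[unfolded in_closure_of, THEN conjunct2, THEN spec[of _ "?T1 \<inter> ?T2"], THEN mp, OF conjI]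
    by (simp only:)
  then obtain \<delta> where \<delta>_class: "\<delta> \<in> class_loops S x f" and \<delta>_T: "\<delta> \<in> ?T1" "\<delta> \<in> ?T2"
    by (elim exE conjE IntE)
  have \<delta>: "\<delta> \<in> loops_at S x" "path_class S \<delta> = path_class S f"
    using \<delta>_class by (simp_all add: class_loops_def topspace_loop_space)
  have \<delta>U: "\<delta> \<in> subordinate n t U"
    using \<delta>_T(1) unfolding subordinate_def by blast
  have \<delta>W: "\<delta> (t i) \<in> W i" if "i \<in> {1..<n}" for i
    using \<delta>_T(2) that by simp
  have p\<delta>: "path \<delta>" "path_image \<delta> \<subseteq> S" using \<delta>(1) by (auto simp: loops_at_def)
  have "\<exists>l. path l \<and> path_image l \<subseteq> S \<inter> U i \<inter> U (Suc i) \<and>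
      pathstart l = h (t i) \<and> pathfinish l = \<delta> (t i)" if i: "i \<in> {1..<n}" for i
  proof -
    obtain l where "path l" "path_image l \<subseteq> W i" "pathstart l = h (t i)" "pathfinish l = \<delta> (t i)"
      using W[OF i] \<delta>W[OF i] unfolding path_connected_def by blast
    then show ?thesis
      using W[OF i] openin_subset[OF W[OF i, THEN conjunct1]] unfolding topspace_euclidean_subtopology by blast
  qed
  then obtain \<gamma> where \<gamma>: "homotopic_paths S \<gamma> \<delta>" "\<gamma> \<in> subordinate n t U"
    "\<forall>i\<in>{1..<n}. \<gamma> (t i) = h (t i)"
    using homotopic_through_points[OF t p\<delta> \<delta>U, of "\<lambda>i. h (t i)"] by blast
  have "homotopic_paths S \<gamma> f"
    using \<gamma>(1) \<delta>(2) homotopic_paths_trans path_class_eq_iff[OF p\<delta>] by blast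
  moreover have "\<gamma> (t i) = h (t i)" if i: "i \<in> {0..n}" for i
  proof -
    have ends: "\<gamma> 0 = h 0" "\<gamma> 1 = h 1"
      using homotopic_paths_imp_pathstart[OF \<gamma>(1)] homotopic_paths_imp_pathfinish[OF \<gamma>(1)] \<delta>(1) h
      by (auto simp: loops_at_def pathstart_def pathfinish_def)
    consider "i = 0" | "i = n" | "i \<in> {1..<n}" using i by fastforce
    then show ?thesis using ends t(1,2) \<gamma>(3) by cases simp_all
  qed
  moreover have "path \<gamma>" "path_image \<gamma> \<subseteq> S"
    using homotopic_paths_imp_path[OF \<gamma>(1)] homotopic_paths_imp_subset[OF \<gamma>(1)] by simp_all
  ultimately show "\<exists>\<gamma>. path \<gamma> \<and> path_image \<gamma> \<subseteq> S \<and> (\<forall>i\<in>{1..n}. \<gamma> ` {t (i - 1)..t i} \<subseteq> U i) \<and>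
      (\<forall>i\<in>{0..n}. \<gamma> (t i) = h (t i)) \<and> homotopic_paths S \<gamma> f"
    using \<gamma>(2)[unfolded subordinate_def, THEN CollectD] by (intro exI[of _ \<gamma>] conjI ballI) simp_all
qed

section \<open>Closed subsets of the fundamental group\<close>

lemma continuous_map_closure_subset:
  assumes "continuous_map X Y \<phi>" "z \<in> X closure_of A" "\<phi> ` A \<subseteq> B"
  shows "\<phi> z \<in> Y closure_of B"
  using continuous_map_image_closure_subset[OF assms(1), of A] closure_of_mono[OF assms(3), of Y] assms(2)
  by blast

theorem mainTheorem8:
  fixes S :: "'a::topological_space set" and x :: 'a
  assumes "path_connected S" and "locally path_connected S" and "x \<in> S"
  shows "(\<forall>H. H \<subset> carrier (fundamental_group S x) \<longrightarrow>
            closedin (pi1_qtop S x) H \<longrightarrow> pi_qs S x H = H) \<and>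
         (t1_space (pi1_qtop S x) \<longleftrightarrow>
            pi_qs S x {\<one>\<^bsub>fundamental_group S x\<^esub>} = {\<one>\<^bsub>fundamental_group S x\<^esub>})"
proof -
  let ?G = "fundamental_group S x" and ?L = "loop_space S x"
  interpret group ?G by (rule group_fundamental_group[OF assms(3)])
  have car: "carrier ?G = path_class S ` loops_at S x"
    by (simp add: fundamental_group_def)
  have in_car: "path_class S f \<in> carrier ?G" if "f \<in> loops_at S x" for f
    using that by (simp add: car)
  have closedin_iff: "closedin (pi1_qtop S x) H \<longleftrightarrow> closedin ?L {g \<in> topspace ?L. path_class S g \<in> H}"
    if "H \<subseteq> carrier ?G" for H
    using quotient_map_quotient_topology[of ?L "path_class S"] that
    unfolding quotient_map_closedin by (simp flip: pi1_qtop_def add: topspace_pi1_qtop)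
  have loop: "g \<in> loops_at S x" if "g \<in> topspace ?L" for g
    using that by (simp add: topspace_loop_space)
  have close_refl: "homotopically_close S f f" if "f \<in> loops_at S x" for f
    unfolding homotopically_close_def using that
    by (intro conjI allI impI exI[of _ f]) (simp_all add: loops_at_def del: image_subset_iff)
  have qs_closed: "pi_qs S x H = H" if H: "H \<subseteq> carrier ?G" "closedin (pi1_qtop S x) H" for H
  proof
    show "H \<subseteq> pi_qs S x H"
      using H(1) close_refl unfolding pi_qs_def car by blast
    show "pi_qs S x H \<subseteq> H"
    proof
      fix A assume "A \<in> pi_qs S x H"
      then obtain f h where f: "f \<in> loops_at S x" "A = path_class S f"
        and h: "h \<in> loops_at S x" "path_class S h \<in> H" and close: "homotopically_close S f h"
        by (auto simp: pi_qs_def)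
      let ?C = "{g \<in> topspace ?L. path_class S g \<in> H}"
      have "closedin ?L ?C" using H closedin_iff by simp
      \<comment> \<open>The operation carries the class of \<open>f\<close> into the class of \<open>h\<close>, thus into \<open>?C\<close>,
        and carries \<open>h\<close> into the class of \<open>f\<close>.\<close>
      moreover have "heap_op f h (restrict h {0..1}) \<in> ?L closure_of ?C"
      proof (rule continuous_map_closure_subset[OF continuous_map_heap_op[OF f(1) h(1)]
            homotopically_close_imp_closure[OF f(1) h(1) close]])
        show "heap_op f h ` class_loops S x f \<subseteq> ?C"
          using f h in_car loop heap_op_in_loop_space[OF f(1) _ h(1)]
          by (auto simp: class_loops_def path_class_heap_op[OF assms(3)] simp flip: m_assoc)
      qed
      ultimately have "path_class S (heap_op f h (restrict h {0..1})) \<in> H"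
        by (auto dest: closure_of_minimal[OF subset_refl])
      then show "A \<in> H"
        using f h in_car restrict_in_loop_space(1)[OF h(1)] loop
        by (simp add: path_class_heap_op[OF assms(3)] path_class_restrict)
    qed
  qed
  have "closedin (pi1_qtop S x) {path_class S f}"
    if qs: "pi_qs S x {\<one>\<^bsub>?G\<^esub>} = {\<one>\<^bsub>?G\<^esub>}" and f: "f \<in> loops_at S x" for f
  proof -
    let ?c = "\<lambda>_::real. x"
    have c: "?c \<in> loops_at S x" "path_class S ?c = \<one>\<^bsub>?G\<^esub>"
      using const_in_loops_at[OF assms(3)] by (simp_all add: fundamental_group_def)
    have "h \<in> class_loops S x f" if hcl: "h \<in> ?L closure_of class_loops S x f" for h
    proof -
      have hL: "h \<in> topspace ?L" using hcl closure_of_subset_topspace by fastforce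
      then have h: "h \<in> loops_at S x" by (rule loop)
      \<comment> \<open>With a constant loop in the third slot the heap operation is \<open>g \<mapsto> h g\<inverse>\<close> up to homotopy,
        which sends \<open>h\<close> to the null-homotopic loop \<open>?h\<close>.\<close>
      let ?f = "h +++ (reversepath f +++ ?c)" and ?h = "h +++ (reversepath h +++ ?c)"
      have fh: "?f \<in> loops_at S x" "?h \<in> loops_at S x"
        by (intro heap_op_loop h f c)+
      have cls: "path_class S (h +++ (reversepath g +++ ?c)) = path_class S (heap_op h ?c g)"
        if "g \<in> loops_at S x" for g
        unfolding heap_op_def by (rule path_class_restrict[OF heap_op_loop[OF h that c(1)], symmetric])
      have "heap_op h ?c h \<in> ?L closure_of class_loops S x ?f"
      proof (rule continuous_map_closure_subset[OF continuous_map_heap_op[OF h c(1)] hcl])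
        show "heap_op h ?c ` class_loops S x f \<subseteq> class_loops S x ?f"
          using f h c loop heap_op_in_loop_space[OF h _ c(1)]
          by (auto simp: class_loops_def path_class_heap_op[OF assms(3)] cls)
      qed
      then have "homotopically_close S ?f ?h"
        unfolding heap_op_def by (rule closure_imp_homotopically_close[OF assms(2) fh])
      moreover have "path_class S ?h = \<one>\<^bsub>?G\<^esub>"
        using h c in_car by (simp add: cls path_class_heap_op[OF assms(3)])
      ultimately have "path_class S ?f \<in> pi_qs S x {\<one>\<^bsub>?G\<^esub>}"
        using fh unfolding pi_qs_def by blast
      then have "path_class S h \<otimes>\<^bsub>?G\<^esub> inv\<^bsub>?G\<^esub> path_class S f = \<one>\<^bsub>?G\<^esub>"
        using qs h f c in_car by (simp add: cls path_class_heap_op[OF assms(3)])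
      then have "path_class S h = path_class S f"
        using inv_equality[OF _ inv_closed[OF in_car[OF f]] in_car[OF h]] in_car[OF f] by simp
      then show ?thesis using hL by (simp add: class_loops_def)
    qed
    then have "?L closure_of class_loops S x f \<subseteq> class_loops S x f" by (rule subsetI)
    moreover have eq: "class_loops S x f = {g \<in> topspace ?L. path_class S g \<in> {path_class S f}}"
      by (simp add: class_loops_def)
    ultimately have "closedin ?L (class_loops S x f)"
      by (intro closure_of_subset_eq[THEN iffD1] conjI) auto
    then show ?thesis
      using in_car[OF f] unfolding eq by (intro closedin_iff[THEN iffD2]) simp_all
  qed
  then have "t1_space (pi1_qtop S x)" if "pi_qs S x {\<one>\<^bsub>?G\<^esub>} = {\<one>\<^bsub>?G\<^esub>}"
    unfolding t1_space_closedin_singleton topspace_pi1_qtop car using that by blast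
  moreover have "pi_qs S x {\<one>\<^bsub>?G\<^esub>} = {\<one>\<^bsub>?G\<^esub>}" if "t1_space (pi1_qtop S x)"
    by (rule qs_closed) (use that in \<open>simp_all add: t1_space_closedin_singleton topspace_pi1_qtop\<close>)
  ultimately show ?thesis
    using qs_closed by blast
qed

end
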